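(* Let $V$ be a finite-dimensional complex vector space and consider an oriented quantum state model (as defined in the context) whose crossing operator is of product form $R=F\otimes G$ with $F,G\in GL(V)$, where $R$ is attached to positive crossings and $\overline R=R^{-1}$ to negative crossings. Let $s$ be the nonzero scalar with $R=s\,I_{V\otimes V}$, let $\delta$ be the value of an oriented circle, let $\langle K\rangle$ be the state sum normalized so that the circle has value $1$, and put $f_K=(s\delta)^{-w(K)}\langle K\rangle$, where $w(K)$ is the writhe. Then the invariant $f$ is trivial for oriented knots: $f_K=1$ for every oriented diagram $K$ of any knot.
   Context: An oriented quantum state model: choose a basis of $V$ indexed by $\{1,\dots,n\}$. To each oriented minimum (cup) and each oriented maximum (cap), for each of the two possible orientations, is attached a matrix indexed by its two endpoints; to crossings with both strands oriented upward are attached the entries $R^{ab}_{cd}$ or $\overline R^{ab}_{cd}$ ($a,b$ labelling the upper left and upper right endpoints, $c,d$ the lower left and lower right ones), where $R$ is an invertible operator on $V\otimes V$ given by $R(e_a\otimes e_b)=\sum_{c,d}R^{ab}_{cd}\,e_c\otimes e_d$, and $\overline R=R^{-1}$. One of $R,\overline R$ is attached to positive crossings and the other to negative crossings. Every oriented link or tangle diagram can be put by planar isotopy in general position with respect to the vertical, with all crossings having both strands oriented upward. It is then assigned the tensor obtained by labelling all endpoints of cups, caps and crossings by indices (joined endpoints receiving the same label), multiplying the corresponding entries and summing over the labels of internal arcs; for a link diagram $K$ this is a number $Z(K)$. The model is required to be such that two oriented tangle diagrams with the same endpoints that are related by planar isotopy (fixing the endpoints) and oriented second and third Reidemeister moves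 receive the same tensor; in particular $R$ satisfies the Yang-Baxter equation $(R\otimes I)(I\otimes R)(R\otimes I)=(I\otimes R)(R\otimes I)(I\otimes R)$. A crossingless circle of either orientation has the same nonzero value $\delta$, and $\langle K\rangle=Z(K)/\delta$. When $R=F\otimes G$ with $F,G$ invertible, the Yang-Baxter equation forces $R=s\,I$ for a nonzero scalar $s$. The writhe $w(K)$ is the sum of the signs of the crossings; a crossing with both strands oriented upward is positive if its overcrossing strand runs from lower left to upper right, and negative otherwise. *)

theory Defs
  imports "HOL-Analysis.Analysis"
begin

section \<open>Oriented tangle diagrams in general position\<close>

text \<open>
  A diagram in general position with respect to the vertical is read from bottom to top as a list
  of slices. Each slice contains exactly one minimum, maximum or crossing, and vertical strands to
  its left and right, recorded by their orientations. All crossings have both strands oriented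
  upward.
\<close>

datatype dir = Up | Down

fun opp :: "dir \<Rightarrow> dir" where
  "opp Up = Down"
| "opp Down = Up"

text \<open>The overcrossing strand starts at the lower left or at the lower right endpoint.\<close>

datatype over = From_Left | From_Right

fun other :: "over \<Rightarrow> over" where
  "other From_Left = From_Right"
| "other From_Right = From_Left"

text \<open>
  \<open>Cup d\<close> and \<open>Cap d\<close> are the oriented minimum and maximum whose left endpoint has orientation
  \<open>d\<close>; the right endpoint then has the opposite orientation.
\<close>

datatype piece = Cup dir | Cap dir | Crossing over

fun piece_bot :: "piece \<Rightarrow> dir list" where
  "piece_bot (Cup d) = []"
| "piece_bot (Cap d) = [d, opp d]"
| "piece_bot (Crossing ov) = [Up, Up]"

fun piece_top :: "piece \<Rightarrow> dir list" where
  "piece_top (Cup d) = [d, opp d]"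
| "piece_top (Cap d) = []"
| "piece_top (Crossing ov) = [Up, Up]"

type_synonym slice = "dir list \<times> piece \<times> dir list"
type_synonym diagram = "slice list"

fun slice_bot :: "slice \<Rightarrow> dir list" where
  "slice_bot (l, p, r) = l @ piece_bot p @ r"

fun slice_top :: "slice \<Rightarrow> dir list" where
  "slice_top (l, p, r) = l @ piece_top p @ r"

text \<open>\<open>tangle a D b\<close>: \<open>D\<close> is a diagram with lower endpoints \<open>a\<close> and upper endpoints \<open>b\<close>.\<close>

fun tangle :: "dir list \<Rightarrow> diagram \<Rightarrow> dir list \<Rightarrow> bool" where
  "tangle a [] b \<longleftrightarrow> a = b"
| "tangle a (x # D) b \<longleftrightarrow> slice_bot x = a \<and> tangle (slice_top x) D b"

abbreviation link_diagram :: "diagram \<Rightarrow> bool" where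
  "link_diagram K \<equiv> tangle [] K []"

text \<open>\<open>circle d\<close> has its left-hand arc oriented by \<open>d\<close>.\<close>

definition circle :: "dir \<Rightarrow> diagram" where
  "circle d = [([], Cup d, []), ([], Cap d, [])]"

fun crossing_sign :: "over \<Rightarrow> int" where
  "crossing_sign From_Left = 1"
| "crossing_sign From_Right = -1"

fun slice_sign :: "slice \<Rightarrow> int" where
  "slice_sign (l, Crossing ov, r) = crossing_sign ov"
| "slice_sign (l, _, r) = 0"

definition writhe :: "diagram \<Rightarrow> int" where
  "writhe D = (\<Sum>x\<leftarrow>D. slice_sign x)"

section \<open>Components\<close>

text \<open>
  The point \<open>(i, j)\<close> is the \<open>j\<close>-th strand at the horizontal level below slice \<open>i\<close> (for
  \<open>i = length K\<close>: above the last slice). \<open>slice_arcs\<close> lists the pairs of points that are joined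
  by an arc within slice \<open>i\<close>.
\<close>

fun slice_arcs :: "nat \<Rightarrow> slice \<Rightarrow> ((nat \<times> nat) \<times> (nat \<times> nat)) set" where
  "slice_arcs i (l, p, r) =
     {((i, j), (Suc i, j)) | j. j < length l} \<union>
     {((i, length l + length (piece_bot p) + j), (Suc i, length l + length (piece_top p) + j))
        | j. j < length r} \<union>
     (case p of
        Cup d \<Rightarrow> {((Suc i, length l), (Suc i, Suc (length l)))}
      | Cap d \<Rightarrow> {((i, length l), (i, Suc (length l)))}
      | Crossing ov \<Rightarrow> {((i, length l), (Suc i, Suc (length l))),
                       ((i, Suc (length l)), (Suc i, length l))})"

text \<open>A link diagram has no points at levels \<open>0\<close> and \<open>length K\<close>.\<close>

definition link_points :: "diagram \<Rightarrow> (nat \<times> nat) set" where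
  "link_points K = {(i, j). i < length K \<and> j < length (slice_bot (K ! i))}"

definition arcs :: "diagram \<Rightarrow> ((nat \<times> nat) \<times> (nat \<times> nat)) set" where
  "arcs K = (\<Union>i<length K. slice_arcs i (K ! i))"

definition link_components :: "diagram \<Rightarrow> (nat \<times> nat) set set" where
  "link_components K = link_points K // (arcs K \<union> (arcs K)\<inverse>)\<^sup>*"

definition knot_diagram :: "diagram \<Rightarrow> bool" where
  "knot_diagram K \<longleftrightarrow> link_diagram K \<and> card (link_components K) = 1"

section \<open>Planar isotopy and oriented second and third Reidemeister moves\<close>

definition place :: "dir list \<Rightarrow> dir list \<Rightarrow> diagram \<Rightarrow> diagram" where
  "place l r D = map (\<lambda>(l', p, r'). (l @ l', p, r' @ r)) D"

text \<open>
  \<open>cross d e ov\<close> is a crossing in which the strand joining lower left to upper right has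
  orientation \<open>d\<close> and the strand joining lower right to upper left has orientation \<open>e\<close>, turned
  by planar isotopy so that the crossing itself is oriented upward; \<open>ov\<close> tells whether the
  overcrossing strand is the one at the lower left or at the lower right. Turning by a quarter
  exchanges the roles of the two strands, whence \<open>other ov\<close> in the antiparallel cases.
\<close>

fun cross :: "dir \<Rightarrow> dir \<Rightarrow> over \<Rightarrow> diagram" where
  "cross Up Up ov = [([], Crossing ov, [])]"
| "cross Up Down ov =
     [([], Cup Down, [Up, Down]),
      ([Down], Crossing (other ov), [Down]),
      ([Down, Up], Cap Up, [])]"
| "cross Down Up ov =
     [([Down, Up], Cup Up, []),
      ([Down], Crossing (other ov), [Down]),
      ([], Cap Down, [Up, Down])]"
| "cross Down Down ov =
     [([Down, Down], Cup Up, []),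
      ([Down, Down, Up], Cup Up, [Down]),
      ([Down, Down], Crossing ov, [Down, Down]),
      ([Down], Cap Down, [Up, Down, Down]),
      ([], Cap Down, [Down, Down])]"

text \<open>The downward crossing obtained by a half turn in the other direction.\<close>

definition cross_down' :: "over \<Rightarrow> diagram" where
  "cross_down' ov =
     [([], Cup Down, [Down, Down]),
      ([Down], Cup Down, [Up, Down, Down]),
      ([Down, Down], Crossing ov, [Down, Down]),
      ([Down, Down, Up], Cap Up, [Down]),
      ([Down, Down], Cap Up, [])]"

text \<open>
  Two diagrams in general position are planar isotopic (with endpoints fixed) iff they are related
  by interchanging the heights of distant pieces, cancelling a minimum against an adjacent maximum,
  and turning a crossing through a full circle, expressed here as the equality of its two half
  turns.
\<close>

inductive isotopy_move :: "diagram \<Rightarrow> diagram \<Rightarrow> bool" where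
  interchange:
    "isotopy_move
       [([], p, m @ piece_bot q), (piece_top p @ m, q, [])]
       [(piece_bot p @ m, q, []), ([], p, m @ piece_top q)]"
| zigzag_right: "isotopy_move [([d], Cup (opp d), []), ([], Cap d, [d])] []"
| zigzag_left: "isotopy_move [([], Cup d, [d]), ([d], Cap (opp d), [])] []"
| turn: "isotopy_move (cross Down Down ov) (cross_down' ov)"

text \<open>The second move, for all orientations \<open>d\<close>, \<open>e\<close> of the two strands.\<close>

inductive R2_move :: "diagram \<Rightarrow> diagram \<Rightarrow> bool" where
  "R2_move (cross d e ov @ cross e d (other ov)) []"

text \<open>
  The third move, for all orientations of three strands numbered from left to right at the bottom,
  the heights \<open>h1\<close>, \<open>h2\<close>, \<open>h3\<close> (nearness to the viewer) telling which strand passes over which.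
\<close>

definition upper :: "nat \<Rightarrow> nat \<Rightarrow> over" where
  "upper h k = (if h > k then From_Left else From_Right)"

inductive R3_move :: "diagram \<Rightarrow> diagram \<Rightarrow> bool" where
  "distinct [h1, h2, h3] \<Longrightarrow>
     R3_move
       (place [] [d3] (cross d1 d2 (upper h1 h2)) @
        place [d2] [] (cross d1 d3 (upper h1 h3)) @
        place [] [d1] (cross d2 d3 (upper h2 h3)))
       (place [d1] [] (cross d2 d3 (upper h2 h3)) @
        place [] [d2] (cross d1 d3 (upper h1 h3)) @
        place [d3] [] (cross d1 d2 (upper h1 h2)))"

text \<open>A local move inside a larger diagram; the two diagrams have the same endpoints.\<close>

inductive diagram_step ::
    "dir list \<Rightarrow> dir list \<Rightarrow> diagram \<Rightarrow> diagram \<Rightarrow> bool" for a b where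
  "\<lbrakk>isotopy_move L L' \<or> R2_move L L' \<or> R3_move L L';
    tangle a (D1 @ place l r L @ D2) b; tangle a (D1 @ place l r L' @ D2) b\<rbrakk>
   \<Longrightarrow> diagram_step a b (D1 @ place l r L @ D2) (D1 @ place l r L' @ D2)"

definition regularly_isotopic ::
    "dir list \<Rightarrow> dir list \<Rightarrow> diagram \<Rightarrow> diagram \<Rightarrow> bool" where
  "regularly_isotopic a b = equivclp (diagram_step a b)"

section \<open>Oriented quantum state models\<close>

text \<open>
  The basis of \<open>V\<close> is indexed by the finite type \<open>'n\<close>, so that \<open>V = complex ^ 'n\<close> and operators on
  \<open>V \<otimes> V\<close> are matrices indexed by \<open>'n \<times> 'n\<close>. With \<open>R (e\<^sub>a \<otimes> e\<^sub>b) = \<Sum> R\<^sup>a\<^sup>b\<^sub>c\<^sub>d (e\<^sub>c \<otimes> e\<^sub>d)\<close> the entry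
  \<open>R\<^sup>a\<^sup>b\<^sub>c\<^sub>d\<close> stands in row \<open>(c, d)\<close> and column \<open>(a, b)\<close>.
  In \<open>cup_mat d\<close> and \<open>cap_mat d\<close> the row index belongs to the left endpoint and the column index to
  the right endpoint.
\<close>

record 'n state_model =
  cup_mat :: "dir \<Rightarrow> complex ^ 'n ^ 'n"
  cap_mat :: "dir \<Rightarrow> complex ^ 'n ^ 'n"
  crossing_op :: "complex ^ ('n \<times> 'n) ^ ('n \<times> 'n)"
  R_at_positive :: bool

definition crossing_mat ::
    "'n::finite state_model \<Rightarrow> over \<Rightarrow> complex ^ ('n \<times> 'n) ^ ('n \<times> 'n)" where
  "crossing_mat M ov =
     (if (crossing_sign ov = 1) = R_at_positive M then crossing_op M
      else matrix_inv (crossing_op M))"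

text \<open>The first list labels the lower endpoints of the piece, the second its upper endpoints.\<close>

fun piece_entry :: "'n::finite state_model \<Rightarrow> piece \<Rightarrow> 'n list \<Rightarrow> 'n list \<Rightarrow> complex" where
  "piece_entry M (Cup e) [] [a, b] = cup_mat M e $ a $ b"
| "piece_entry M (Cap e) [c, d] [] = cap_mat M e $ c $ d"
| "piece_entry M (Crossing ov) [c, d] [a, b] = crossing_mat M ov $ (c, d) $ (a, b)"
| "piece_entry M _ _ _ = 0"

fun slice_entry :: "'n::finite state_model \<Rightarrow> slice \<Rightarrow> 'n list \<Rightarrow> 'n list \<Rightarrow> complex" where
  "slice_entry M (l, p, r) u v =
     piece_entry M p (take (length (piece_bot p)) (drop (length l) u))
                     (take (length (piece_top p)) (drop (length l) v))"

text \<open>Labels below and above a slice are compatible if every vertical strand carries one label.\<close>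

fun compatible :: "slice \<Rightarrow> 'n list \<Rightarrow> 'n list \<Rightarrow> bool" where
  "compatible (l, p, r) u v \<longleftrightarrow>
     length u = length (slice_bot (l, p, r)) \<and> length v = length (slice_top (l, p, r)) \<and>
     take (length l) u = take (length l) v \<and>
     drop (length l + length (piece_bot p)) u = drop (length l + length (piece_top p)) v"

text \<open>
  A labelling of the arcs of a diagram is recorded by the labels it induces at each horizontal
  level; \<open>u\<close> and \<open>v\<close> are the prescribed labels of the lower and upper endpoints.
\<close>

definition labellings :: "diagram \<Rightarrow> 'n list \<Rightarrow> 'n list \<Rightarrow> 'n list list set" where
  "labellings D u v =
     {\<sigma>. length \<sigma> = Suc (length D) \<and> \<sigma> ! 0 = u \<and> \<sigma> ! length D = v \<and>
         (\<forall>i<length D. compatible (D ! i) (\<sigma> ! i) (\<sigma> ! Suc i))}"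

definition tensor :: "'n::finite state_model \<Rightarrow> diagram \<Rightarrow> 'n list \<Rightarrow> 'n list \<Rightarrow> complex" where
  "tensor M D u v =
     (\<Sum>\<sigma>\<in>labellings D u v. \<Prod>i<length D. slice_entry M (D ! i) (\<sigma> ! i) (\<sigma> ! Suc i))"

definition state_sum :: "'n::finite state_model \<Rightarrow> diagram \<Rightarrow> complex" where
  "state_sum M K = tensor M K [] []"

text \<open>State models are required below to give the circle the same value for both orientations.\<close>

definition circle_value :: "'n::finite state_model \<Rightarrow> complex" where
  "circle_value M = state_sum M (circle Up)"

definition oriented_quantum_state_model :: "'n::finite state_model \<Rightarrow> bool" where
  "oriented_quantum_state_model M \<longleftrightarrow>
     invertible (crossing_op M) \<and>
     (\<forall>a b D D' u v. regularly_isotopic a b D D' \<and> tangle a D b \<and> tangle a D' b \<and>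
        length u = length a \<and> length v = length b \<longrightarrow> tensor M D u v = tensor M D' u v) \<and>
     (\<forall>d. state_sum M (circle d) = circle_value M) \<and>
     circle_value M \<noteq> 0"

definition bracket :: "'n::finite state_model \<Rightarrow> diagram \<Rightarrow> complex" where
  "bracket M K = state_sum M K / circle_value M"

definition normalized_invariant :: "'n::finite state_model \<Rightarrow> complex \<Rightarrow> diagram \<Rightarrow> complex" where
  "normalized_invariant M s K = (s * circle_value M) powi (- writhe K) * bracket M K"

text \<open>The matrix of \<open>F \<otimes> G\<close>, i.e. \<open>e\<^sub>a \<otimes> e\<^sub>b \<mapsto> F e\<^sub>a \<otimes> G e\<^sub>b\<close>.\<close>

definition kronecker ::
    "complex ^ 'n ^ 'n \<Rightarrow> complex ^ 'n ^ 'n \<Rightarrow> complex ^ ('n::finite \<times> 'n) ^ ('n \<times> 'n)" where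
  "kronecker F G = (\<chi> p q. F $ fst p $ fst q * G $ snd p $ snd q)"

end

theory Submission
  imports Defs
begin

text \<open>
  Since \<open>R = s I\<close>, a crossing merely contributes the factor \<open>s\<close> or \<open>1 / s\<close> and is replaced by two
  parallel vertical strands. In the second Reidemeister move for antiparallel strands this
  replacement leaves a maximum, a circle and a minimum, an operator of rank one, which by invariance
  is the identity of \<open>V \<otimes> V\<^sup>*\<close>. Hence \<open>V\<close> has dimension one (\<open>scalar_crossing_dimension\<close>).

  In dimension one, state sums are products of numbers attached to the pieces. Cancelling
  minima against adjacent maxima shows that \<open>\<delta> = \<plusminus>1\<close> and that, up to factors cancelling in a link
  diagram, a minimum or maximum weighs \<open>\<delta>\<close> if it is \<open>Cup Up\<close> or \<open>Cap Down\<close> and \<open>1\<close> otherwise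
  (\<open>slice_weight\<close>). So the state sum is \<open>s\<close> to the writhe, times \<open>\<delta>\<close> to the rotation number of the
  diagram. Splitting off \<open>\<delta>\<close> to the writhe, which has the parity of the number of crossings, the
  claim becomes Whitney's rule that for a knot the rotation number and the number of crossings have
  an odd sum (\<open>knot_parity\<close>).

  To prove Whitney's rule, the diagram is built up from the bottom, and each strand of the part
  built so far carries a colour of its own. The row of strand ends on top is a word in letters
  (colour, orientation), and its sign, the parity of its inversions, can be followed through every
  slice (\<open>recolour_slice\<close>): up to \<open>-1\<close> to the number of colours, it is the product of the signs
  \<open>slice_parity\<close>. At the end the word is empty and a knot has one colour.
\<close>

section \<open>The sign of a word\<close>

definition pair_sign :: "'a::linorder \<Rightarrow> 'a \<Rightarrow> int" where
  "pair_sign x y = (if y < x then -1 else 1)"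

text \<open>
  The sign of the permutation that sorts a word without repetitions, as the product of \<open>-1\<close> over
  its inversions.
\<close>

fun word_sign :: "'a::linorder list \<Rightarrow> int" where
  "word_sign [] = 1"
| "word_sign (x # xs) = (\<Prod>y\<leftarrow>xs. pair_sign x y) * word_sign xs"

lemma pair_sign_swap: "x \<noteq> y \<Longrightarrow> pair_sign x y = - pair_sign y x"
  by (auto simp: pair_sign_def)

lemma word_sign_swap_adjacent:
  "x \<noteq> y \<Longrightarrow> word_sign (u @ [y, x] @ v) = - word_sign (u @ [x, y] @ v)"
  by (induction u) (simp_all add: pair_sign_swap[of x y])

text \<open>
  Exchanging two letters is a product of an odd number of adjacent transpositions: \<open>y\<close> moves to the
  right past \<open>m\<close> and \<open>x\<close>, then \<open>x\<close> moves to the left past \<open>m\<close>.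
\<close>

lemma word_sign_exchange:
  assumes "x \<noteq> y" "x \<notin> set m" "y \<notin> set m"
  shows "word_sign (u @ y # m @ x # v) = - word_sign (u @ x # m @ y # v)"
  using assms
proof (induction m arbitrary: u)
  case Nil
  then show ?case using word_sign_swap_adjacent[of x y u v] by simp
next
  case (Cons z m)
  have "word_sign (u @ y # z # m @ x # v) = - word_sign (u @ z # y # m @ x # v)"
    using word_sign_swap_adjacent[of z y u "m @ x # v"] Cons.prems by auto
  also have "\<dots> = word_sign (u @ z # x # m @ y # v)"
    using Cons.IH[of "u @ [z]"] Cons.prems by simp
  also have "\<dots> = - word_sign (u @ x # z # m @ y # v)"
    using word_sign_swap_adjacent[of x z u "m @ y # v"] Cons.prems by simp
  finally show ?case by simp
qed

section \<open>The sign of a row of coloured strand ends\<close>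

text \<open>
  A strand end is a pair of a colour, naming the strand, and an orientation. The code puts the two
  ends of one strand next to each other in the order of the natural numbers. So an end compares in
  the same way with both ends of any other strand, and the sign of a row that contains both ends of
  each of its strands does not depend on the choice of the colours.
\<close>

fun end_code :: "nat \<times> dir \<Rightarrow> nat" where
  "end_code (c, Up) = 2 * c"
| "end_code (c, Down) = Suc (2 * c)"

abbreviation ends_sign :: "(nat \<times> dir) list \<Rightarrow> int" where
  "ends_sign ws \<equiv> word_sign (map end_code ws)"

lemma end_code_less:
  "c \<noteq> c' \<Longrightarrow> end_code (c, d) < end_code (c', d') \<longleftrightarrow> c < c'"
  by (cases d; cases d') auto

lemma end_code_inj [simp]: "end_code e = end_code e' \<longleftrightarrow> e = e'"
proof -
  obtain c d c' d' where [simp]: "e = (c, d)" "e' = (c', d')" by (cases e; cases e')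
  show ?thesis
    by (cases d; cases d') (auto, presburger+)
qed

lemma opp_opp [simp]: "opp (opp d) = d" by (cases d) auto
lemma opp_neq [simp]: "opp d \<noteq> d" "d \<noteq> opp d" by (cases d; simp)+

lemma opp_eq_iff [simp]: "opp d = opp e \<longleftrightarrow> d = e" by (cases d; cases e; simp)

lemma dir_neq_iff: "d \<noteq> d' \<longleftrightarrow> d' = opp d" by (cases d; cases d'; simp)

lemma prod_list_mult_eq_1:
  fixes f g :: "'a \<Rightarrow> int"
  assumes "\<And>x. x \<in> set xs \<Longrightarrow> f x * g x = 1"
  shows "(\<Prod>x\<leftarrow>xs. f x) * (\<Prod>x\<leftarrow>xs. g x) = 1"
proof -
  have "(\<Prod>x\<leftarrow>xs. f x) * (\<Prod>x\<leftarrow>xs. g x) = (\<Prod>x\<leftarrow>xs. f x * g x)"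
    by (induction xs) (simp_all add: algebra_simps)
  also have "\<dots> = 1" using assms by (induction xs) simp_all
  finally show ?thesis .
qed

text \<open>
  Every other end is inverted with both members of the pair or with neither. Only the inversion
  within the pair counts, and it is there iff the left end is \<open>Down\<close>.
\<close>

lemma ends_sign_remove_pair:
  assumes "b \<notin> fst ` set u" "b \<notin> fst ` set v"
  shows "ends_sign (u @ (b, d) # (b, opp d) # v) = (if d = Down then -1 else 1) * ends_sign (u @ v)"
  using assms
proof (induction u)
  case Nil
  have "pair_sign (end_code (b, d)) (end_code e) * pair_sign (end_code (b, opp d)) (end_code e) = 1"
    if "e \<in> set v" for e
  proof -
    have "fst e \<noteq> b" using that Nil by auto
    then show ?thesis by (cases e) (simp add: pair_sign_def end_code_less)
  qed
  then have "(\<Prod>e\<leftarrow>v. pair_sign (end_code (b, d)) (end_code e)) * (\<Prod>e\<leftarrow>v. pair_sign (end_code (b, opp d)) (end_code e)) = 1"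
    by (rule prod_list_mult_eq_1)
  then show ?case
    by (cases d) (auto simp: pair_sign_def o_def algebra_simps)
next
  case (Cons e u)
  have "pair_sign (end_code e) (end_code (b, d)) * pair_sign (end_code e) (end_code (b, opp d)) = 1"
    using Cons.prems by (cases e) (auto simp: pair_sign_def end_code_less)
  moreover have "ends_sign (u @ (b, d) # (b, opp d) # v) = (if d = Down then -1 else 1) * ends_sign (u @ v)"
    using Cons by auto
  ultimately show ?case by simp
qed

text \<open>
  The two ends of each strand have opposite orientations: a strand enters the part of the diagram
  below the row at its \<open>Down\<close> end and leaves it at its \<open>Up\<close> end.
\<close>

definition balanced :: "(nat \<times> dir) list \<Rightarrow> bool" where
  "balanced ws \<longleftrightarrow> distinct ws \<and> (\<forall>c d. (c, d) \<in> set ws \<longrightarrow> (c, opp d) \<in> set ws)"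

text \<open>
  A maximum joins the strands \<open>a\<close> and \<open>b\<close> at \<open>(a, d)\<close> and \<open>(b, opp d)\<close>, and the joined strand
  is named \<open>a\<close>. The surviving end \<open>(b, d)\<close> thereby becomes \<open>(a, d)\<close>. This has the same effect as
  exchanging the two letters \<open>(a, d)\<close> and \<open>(b, d)\<close>, which costs a factor \<open>-1\<close>, and then removing
  the adjacent pair \<open>(b, d), (b, opp d)\<close>.
\<close>

lemma balanced_merge:
  fixes a b :: nat
  assumes "balanced (wl @ [(a, d), (b, opp d)] @ wr)" "a \<noteq> b"
  defines "g \<equiv> (\<lambda>c. if c = b then a else c)"
  shows "balanced (map (apfst g) (wl @ wr))" (is ?B)
    and "ends_sign (map (apfst g) (wl @ wr)) =
         (if d = Up then -1 else 1) * ends_sign (wl @ [(a, d), (b, opp d)] @ wr)" (is ?S)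
proof -
  let ?ws = "wl @ [(a, d), (b, opp d)] @ wr"
  have dist: "distinct ?ws" and closed: "\<And>c d. (c, d) \<in> set ?ws \<Longrightarrow> (c, opp d) \<in> set ?ws"
    using assms(1) unfolding balanced_def by blast+
  have g_id: "map (apfst g) u = u" if "b \<notin> fst ` set u" for u :: "(nat \<times> dir) list"
    using that by (intro map_idI) (force simp: g_def)
  have g_b: "apfst g (b, d) = (a, d)" by (simp add: g_def)
  have balI: "balanced ws'" if "distinct ws'" "\<And>c e. (c, e) \<in> set ws' \<longleftrightarrow> (c, e) \<in> set ?ws \<and> c \<noteq> b" for ws'
    using that closed unfolding balanced_def by blast
  have sgn: "- (if d = Down then -1 else 1 :: int) = (if d = Up then -1 else 1)" by (cases d) auto
  have only_b: "e = (b, d) \<or> e = (b, opp d)" if "fst e = b" for e :: "nat \<times> dir"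
    using that by (cases e) (auto simp: dir_neq_iff)
  have "(b, d) \<in> set wl \<or> (b, d) \<in> set wr"
    using closed[of b "opp d"] \<open>a \<noteq> b\<close> by auto
  then show ?B ?S
  proof (atomize(full), elim disjE, goal_cases)
    case 1
    then obtain u m where wl: "wl = u @ (b, d) # m" by (meson split_list)
    have fresh: "b \<notin> fst ` set u" "b \<notin> fst ` set m" "b \<notin> fst ` set wr"
      using dist only_b unfolding wl by (auto; metis fst_conv)+
    have new: "map (apfst g) (wl @ wr) = u @ (a, d) # m @ wr"
      using g_id fresh g_b wl by simp
    have "balanced (u @ (a, d) # m @ wr)"
      using dist fresh \<open>a \<noteq> b\<close> by (intro balI) (auto simp: wl image_iff)
    moreover have "ends_sign ?ws = - ends_sign (u @ (a, d) # m @ (b, d) # (b, opp d) # wr)"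
      using word_sign_exchange[of "end_code (a, d)" "end_code (b, d)" "map end_code m"
          "map end_code u" "map end_code ((b, opp d) # wr)"] dist \<open>a \<noteq> b\<close>
      unfolding wl by (auto simp: image_iff)
    moreover have "\<dots> = - (if d = Down then -1 else 1) * ends_sign (u @ (a, d) # m @ wr)"
      using ends_sign_remove_pair[of b "u @ (a, d) # m" wr d] fresh \<open>a \<noteq> b\<close> by (cases d) (auto simp: image_Un)
    ultimately show ?case unfolding new by (auto simp: sgn)
  next
    case 2
    then obtain m v where wr: "wr = m @ (b, d) # v" by (meson split_list)
    have fresh: "b \<notin> fst ` set wl" "b \<notin> fst ` set m" "b \<notin> fst ` set v"
      using dist only_b unfolding wr by (auto; metis fst_conv)+
    have new: "map (apfst g) (wl @ wr) = wl @ m @ (a, d) # v"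
      using g_id fresh g_b wr by simp
    have "balanced (wl @ m @ (a, d) # v)"
      using dist fresh \<open>a \<noteq> b\<close> by (intro balI) (auto simp: wr image_iff)
    moreover have "ends_sign ?ws = - ends_sign (wl @ (b, d) # (b, opp d) # m @ (a, d) # v)"
      using word_sign_exchange[of "end_code (b, d)" "end_code (a, d)" "map end_code ((b, opp d) # m)"
          "map end_code wl" "map end_code v"] dist \<open>a \<noteq> b\<close>
      unfolding wr by (auto simp: image_iff)
    moreover have "\<dots> = - (if d = Down then -1 else 1) * ends_sign (wl @ m @ (a, d) # v)"
      using ends_sign_remove_pair[of b wl "m @ (a, d) # v" d] fresh \<open>a \<noteq> b\<close> by (cases d) (auto simp: image_Un)
    ultimately show ?case unfolding new by (auto simp: sgn)
  qed
qed

section \<open>The parity of the rotation number\<close>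

text \<open>
  The product of these signs over a link diagram is \<open>-1\<close> to the number of crossings plus the
  rotation number: every \<open>Cup Up\<close> and every \<open>Cap Down\<close> contributes \<open>-1\<close>, and since there are as
  many minima as maxima, their total number has the parity of the difference of the numbers of
  \<open>Cup Down\<close> and \<open>Cap Up\<close>, which is the rotation number.
\<close>

fun slice_parity :: "slice \<Rightarrow> int" where
  "slice_parity (l, Cup d, r) = (if d = Up then -1 else 1)"
| "slice_parity (l, Cap d, r) = (if d = Down then -1 else 1)"
| "slice_parity (l, Crossing ov, r) = -1"

text \<open>
  The colours on the two levels bounding slice \<open>n\<close>: those of the row \<open>ws\<close> below, renamed by \<open>g\<close>,
  and those of the row \<open>ws'\<close> above.
\<close>

definition extended_colour :: "nat \<Rightarrow> (nat \<Rightarrow> nat) \<Rightarrow> (nat \<times> dir) list \<Rightarrow> (nat \<times> dir) list \<Rightarrow> nat \<times> nat \<Rightarrow> nat" where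
  "extended_colour n g ws ws' = (\<lambda>(i, j). if i \<le> n then g (fst (ws ! j)) else fst (ws' ! j))"

text \<open>
  Passing one slice upwards. A minimum gets a fresh colour, a crossing swaps two adjacent ends, and
  a maximum closes a strand if its two ends have the same colour and merges two strands otherwise;
  \<open>g\<close> identifies the two colours in the last case and is the identity in all others. The number
  of colours changes only at a minimum, by \<open>1\<close>, and at a merging, by \<open>-1\<close>. Together with the
  change of the sign of the row, each case gives exactly \<open>slice_parity\<close>.
\<close>

lemma recolour_slice:
  assumes "balanced ws" "map snd ws = slice_bot x" "finite C" "fst ` set ws \<subseteq> C"
  obtains g ws' where
    "balanced ws'" "map snd ws' = slice_top x"
    "\<And>p q. (p, q) \<in> slice_arcs n x \<Longrightarrow> extended_colour n g ws ws' p = extended_colour n g ws ws' q"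
    "ends_sign ws' * (-1) ^ card (g ` C \<union> fst ` set ws') = slice_parity x * (ends_sign ws * (-1) ^ card C)"
proof -
  obtain l p r where x: "x = (l, p, r)" by (cases x)
  define wl wp wr where "wl = take (length l) ws"
    and "wp = take (length (piece_bot p)) (drop (length l) ws)"
    and "wr = drop (length l + length (piece_bot p)) ws"
  have ws: "ws = wl @ wp @ wr"
    unfolding wl_def wp_def wr_def by (metis append_take_drop_id drop_drop add.commute)
  have snds: "map snd ws = l @ piece_bot p @ r" using assms(2) x by simp
  have wl: "map snd wl = l" and wp: "map snd wp = piece_bot p" and wr: "map snd wr = r"
    unfolding wl_def wp_def wr_def take_map[symmetric] drop_map[symmetric] snds by simp_all
  have len: "length l = length wl" "length r = length wr" "length wp = length (piece_bot p)"
    using wl wp wr by (metis length_map)+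
  have arcs: "extended_colour n g ws ws' a = extended_colour n g ws ws' b"
    if ws': "ws' = map (apfst g) wl @ wp' @ map (apfst g) wr" and lp: "length wp' = length (piece_top p)"
      and joined: "case p of Cup d \<Rightarrow> fst (wp' ! 0) = fst (wp' ! 1)
        | Cap d \<Rightarrow> g (fst (wp ! 0)) = g (fst (wp ! 1))
        | Crossing ov \<Rightarrow> g (fst (wp ! 0)) = fst (wp' ! 1) \<and> g (fst (wp ! 1)) = fst (wp' ! 0)"
      and ab: "(a, b) \<in> slice_arcs n x" for g ws' wp' a b
  proof -
    let ?t = "extended_colour n g ws ws'"
    have below: "?t (n, j) = g (fst (ws ! j))" and above: "?t (Suc n, j) = fst (ws' ! j)" for j
      by (simp_all add: extended_colour_def)
    have left: "?t (n, j) = ?t (Suc n, j)" if "j < length l" for j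
      using that len unfolding below above by (simp add: ws ws' nth_append)
    have right: "?t (n, length l + length (piece_bot p) + j) =
        ?t (Suc n, length l + length (piece_top p) + j)" if "j < length r" for j
      using that len lp unfolding below above by (simp add: ws ws' nth_append)
    have mid_below: "?t (n, length l + j) = g (fst (wp ! j))" if "j < length (piece_bot p)" for j
      using that len unfolding below by (simp add: ws nth_append)
    have mid_above: "?t (Suc n, length l + j) = fst (wp' ! j)" if "j < length (piece_top p)" for j
      using that len lp unfolding above by (simp add: ws' nth_append)
    have cross: "case p of Cup d \<Rightarrow> ?t (Suc n, length l) = ?t (Suc n, Suc (length l))
        | Cap d \<Rightarrow> ?t (n, length l) = ?t (n, Suc (length l))
        | Crossing ov \<Rightarrow> ?t (n, length l) = ?t (Suc n, Suc (length l)) \<and>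
                         ?t (n, Suc (length l)) = ?t (Suc n, length l)"
      using joined mid_below[of 0] mid_below[of 1] mid_above[of 0] mid_above[of 1]
      by (cases p) simp_all
    show ?thesis
      using ab left right cross unfolding x by (cases p) (simp, blast)+
  qed
  have bal: "distinct ws" "\<And>c d. (c, d) \<in> set ws \<Longrightarrow> (c, opp d) \<in> set ws"
    using assms(1) unfolding balanced_def by blast+
  have apfst_id: "map (apfst (\<lambda>c. c)) w = w" for w :: "(nat \<times> dir) list"
    by (intro map_idI) auto
  show thesis
  proof (cases p)
    case (Cup d)
    obtain c where c: "c \<notin> C" using \<open>finite C\<close> ex_new_if_finite infinite_UNIV_nat by blast
    have [simp]: "wp = []" using wp Cup by simp
    have cws: "c \<notin> fst ` set wl" "c \<notin> fst ` set wr" using c assms(4) ws by auto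
    let ?ws' = "wl @ [(c, d), (c, opp d)] @ wr"
    show thesis
    proof (rule that[of ?ws' "\<lambda>c. c"])
      have "(c', opp d') \<in> set ?ws'" if "(c', d') \<in> set ?ws'" for c' d'
        using that bal(2)[of c' d'] ws by auto
      moreover have "distinct ?ws'"
        using bal(1) cws ws by (auto simp: image_iff)
      ultimately show "balanced ?ws'" unfolding balanced_def by blast
      show "map snd ?ws' = slice_top x" using wl wr x Cup by simp
      show "extended_colour n (\<lambda>c. c) ws ?ws' s = extended_colour n (\<lambda>c. c) ws ?ws' t"
        if "(s, t) \<in> slice_arcs n x" for s t
        using arcs[of ?ws' "\<lambda>c. c" "[(c, d), (c, opp d)]"] that Cup apfst_id by simp
      have "(\<lambda>c. c) ` C \<union> fst ` set ?ws' = insert c C" using assms(4) ws by auto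
      then show "ends_sign ?ws' * (-1) ^ card ((\<lambda>c. c) ` C \<union> fst ` set ?ws') =
            slice_parity x * (ends_sign ws * (-1) ^ card C)"
        using ends_sign_remove_pair[of c wl wr d] cws c \<open>finite C\<close> x Cup ws
        by (cases d) simp_all
    qed
  next
    case (Crossing ov)
    then obtain a b where [simp]: "wp = [(a, Up), (b, Up)]"
      using wp by (auto simp: map_eq_Cons_conv)
    have "a \<noteq> b" using bal(1) ws by auto
    let ?ws' = "wl @ [(b, Up), (a, Up)] @ wr"
    have same: "set ?ws' = set ws" using ws by auto
    show thesis
    proof (rule that[of ?ws' "\<lambda>c. c"])
      have "distinct ?ws'" using bal(1) ws by auto
      then show "balanced ?ws'" using bal(2) unfolding balanced_def same by blast
      show "map snd ?ws' = slice_top x" using wl wr x Crossing by simp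
      show "extended_colour n (\<lambda>c. c) ws ?ws' s = extended_colour n (\<lambda>c. c) ws ?ws' t"
        if "(s, t) \<in> slice_arcs n x" for s t
        using arcs[of ?ws' "\<lambda>c. c" "[(b, Up), (a, Up)]"] that Crossing apfst_id by simp
      have "(\<lambda>c. c) ` C \<union> fst ` set ?ws' = C" using assms(4) unfolding same by auto
      then show "ends_sign ?ws' * (-1) ^ card ((\<lambda>c. c) ` C \<union> fst ` set ?ws') =
            slice_parity x * (ends_sign ws * (-1) ^ card C)"
        using word_sign_swap_adjacent[of "end_code (a, Up)" "end_code (b, Up)"
            "map end_code wl" "map end_code wr"] \<open>a \<noteq> b\<close> x Crossing ws by simp
    qed
  next
    case (Cap d)
    then obtain a b where wp_eq [simp]: "wp = [(a, d), (b, opp d)]"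
      using wp by (auto simp: map_eq_Cons_conv)
    have ab: "a \<in> C" "b \<in> C" using assms(4) ws by auto
    show thesis
    proof (cases "a = b")
      case True
      let ?ws' = "wl @ wr"
      have only_b: "e = (b, d) \<or> e = (b, opp d)" if "fst e = b" for e :: "nat \<times> dir"
        using that by (cases e) (auto simp: dir_neq_iff)
      have fresh: "b \<notin> fst ` set wl" "b \<notin> fst ` set wr"
        using bal(1) only_b True unfolding ws by (auto; metis fst_conv)+
      show thesis
      proof (rule that[of ?ws' "\<lambda>c. c"])
        have "(c', opp d') \<in> set ?ws'" if "(c', d') \<in> set ?ws'" for c' d'
          using that bal(2)[of c' d'] fresh ws True by (auto simp: image_iff)
        then show "balanced ?ws'" using bal(1) ws unfolding balanced_def by auto
        show "map snd ?ws' = slice_top x" using wl wr x Cap by simp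
        show "extended_colour n (\<lambda>c. c) ws ?ws' s = extended_colour n (\<lambda>c. c) ws ?ws' t"
          if "(s, t) \<in> slice_arcs n x" for s t
          using arcs[of ?ws' "\<lambda>c. c" "[]"] that Cap apfst_id True by simp
        have "(\<lambda>c. c) ` C \<union> fst ` set ?ws' = C" using assms(4) ws by auto
        then show "ends_sign ?ws' * (-1) ^ card ((\<lambda>c. c) ` C \<union> fst ` set ?ws') =
            slice_parity x * (ends_sign ws * (-1) ^ card C)"
          using ends_sign_remove_pair[of b wl wr d] fresh True x Cap ws
          by (cases d) simp_all
      qed
    next
      case False
      define g where "g = (\<lambda>c. if c = b then a else c)"
      let ?ws' = "map (apfst g) (wl @ wr)"
      note merge = balanced_merge[of wl a d b wr, folded g_def]
      show thesis
      proof (rule that[of ?ws' g])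
        show "balanced ?ws'" using merge(1) assms(1) ws False by simp
        show "map snd ?ws' = slice_top x" using wl wr x Cap by (simp add: o_def)
        show "extended_colour n g ws ?ws' s = extended_colour n g ws ?ws' t"
          if "(s, t) \<in> slice_arcs n x" for s t
          using arcs[of ?ws' g "[]"] that Cap by (simp add: g_def)
        have "g ` C \<union> fst ` set ?ws' = C - {b}"
          using assms(4) ab False unfolding ws by (auto simp: g_def image_iff split: if_splits)
        moreover have "card C = Suc (card (C - {b}))"
          using ab \<open>finite C\<close> by (metis card.remove)
        ultimately show "ends_sign ?ws' * (-1) ^ card (g ` C \<union> fst ` set ?ws') =
            slice_parity x * (ends_sign ws * (-1) ^ card C)"
          using merge(2) assms(1) ws False x Cap by (cases d) simp_all
      qed
    qed
  qed
qed

lemma tangle_append: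
  "tangle a (D @ E) b \<longleftrightarrow> (\<exists>c. tangle a D c \<and> tangle c E b)"
  by (induction D arbitrary: a) auto

text \<open>
  In contrast to \<open>link_points\<close>, the points on the level above the last slice are included.
\<close>

definition tangle_points :: "diagram \<Rightarrow> dir list \<Rightarrow> (nat \<times> nat) set" where
  "tangle_points D b = link_points D \<union> {length D} \<times> {..<length b}"

lemma link_points_snoc:
  "link_points (D @ [x]) = tangle_points D (slice_bot x)"
  unfolding link_points_def tangle_points_def
  by (auto simp: nth_append less_Suc_eq)

lemma arcs_snoc: "arcs (D @ [x]) = arcs D \<union> slice_arcs (length D) x"
proof -
  have "(\<Union>i<length D. slice_arcs i ((D @ [x]) ! i)) = arcs D"
    unfolding arcs_def by (intro SUP_cong) (simp_all add: nth_append)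
  then show ?thesis unfolding arcs_def[of "D @ [x]"] by (simp add: lessThan_Suc Un_commute)
qed

lemma slice_arcs_levels:
  "(p, q) \<in> slice_arcs i x \<Longrightarrow>
   fst p \<in> {i, Suc i} \<and> fst q \<in> {i, Suc i} \<and>
   (fst p = i \<longrightarrow> snd p < length (slice_bot x)) \<and> (fst q = i \<longrightarrow> snd q < length (slice_bot x))"
proof -
  assume pq: "(p, q) \<in> slice_arcs i x"
  obtain l piece r where x: "x = (l, piece, r)" by (cases x)
  show ?thesis using pq unfolding x by (cases piece) auto
qed

lemma arcs_levels: "(p, q) \<in> arcs D \<Longrightarrow> fst p \<le> length D \<and> fst q \<le> length D"
proof -
  assume "(p, q) \<in> arcs D"
  then obtain i where i: "i < length D" "(p, q) \<in> slice_arcs i (D ! i)" by (auto simp: arcs_def)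
  show ?thesis using slice_arcs_levels[OF i(2)] i(1) by auto
qed

text \<open>
  The invariant behind Whitney's parity rule. The colours name the strands and closed components.
  In a link diagram the top row is empty, so that the product of the slice parities is \<open>-1\<close> to the
  number of colours.
\<close>

lemma tangle_colouring:
  assumes "tangle [] D b"
  shows "\<exists>f ws. (\<forall>(p, q) \<in> arcs D. f p = f q) \<and> balanced ws \<and> map snd ws = b \<and>
     (\<forall>j<length b. f (length D, j) = fst (ws ! j)) \<and> finite (f ` tangle_points D b) \<and>
     ends_sign ws * (-1) ^ card (f ` tangle_points D b) = (\<Prod>x\<leftarrow>D. slice_parity x)"
  using assms
proof (induction D arbitrary: b rule: rev_induct)
  case Nil
  then show ?case
    by (intro exI[of _ "\<lambda>_. 0"] exI[of _ "[]"])
       (auto simp: arcs_def balanced_def tangle_points_def link_points_def)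
next
  case (snoc x D)
  let ?n = "length D" and ?a = "slice_bot x"
  have D: "tangle [] D ?a" and b: "b = slice_top x" using snoc.prems by (auto simp: tangle_append)
  let ?P = "tangle_points D ?a"
  from snoc.IH[OF D] obtain f ws where
    f_arcs: "\<forall>(p, q) \<in> arcs D. f p = f q" and ws: "balanced ws" "map snd ws = ?a"
    and top: "\<forall>j<length ?a. f (?n, j) = fst (ws ! j)"
    and fin: "finite (f ` ?P)"
    and sgn: "ends_sign ws * (-1) ^ card (f ` ?P) = (\<Prod>x\<leftarrow>D. slice_parity x)"
    by (elim exE conjE) (rule that; assumption)
  have f: "f p = f q" if "(p, q) \<in> arcs D" for p q using f_arcs that by blast
  have len: "length ws = length ?a" using ws(2) by (metis length_map)
  have sub: "fst ` set ws \<subseteq> f ` ?P"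
  proof
    fix c assume "c \<in> fst ` set ws"
    then obtain j where j: "j < length ?a" "c = fst (ws ! j)"
      using len by (auto simp: in_set_conv_nth)
    then have "c = f (?n, j)" "(?n, j) \<in> ?P" by (auto simp: top tangle_points_def)
    then show "c \<in> f ` ?P" by blast
  qed
  obtain g ws' where ws': "balanced ws'" "map snd ws' = slice_top x"
    and arcs': "\<And>p q. (p, q) \<in> slice_arcs ?n x \<Longrightarrow> extended_colour ?n g ws ws' p = extended_colour ?n g ws ws' q"
    and sgn': "ends_sign ws' * (-1) ^ card (g ` f ` ?P \<union> fst ` set ws') =
               slice_parity x * (ends_sign ws * (-1) ^ card (f ` ?P))"
    by (rule recolour_slice[OF ws fin sub, where n = ?n]) (rule that)
  have len': "length ws' = length b" using ws'(2) b by (metis length_map)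
  define f' where "f' = (\<lambda>(i, j). if i \<le> ?n then g (f (i, j)) else fst (ws' ! j))"
  have agree: "f' p = extended_colour ?n g ws ws' p"
    if "fst p \<in> {?n, Suc ?n}" "fst p = ?n \<longrightarrow> snd p < length ?a" for p
    using that top by (cases p) (auto simp: f'_def extended_colour_def)
  have f': "f' p = f' q" if "(p, q) \<in> arcs (D @ [x])" for p q
  proof (cases "(p, q) \<in> arcs D")
    case True
    then show ?thesis using f[OF True] arcs_levels[OF True] by (cases p; cases q) (auto simp: f'_def)
  next
    case False
    then have "(p, q) \<in> slice_arcs ?n x" using that by (auto simp: arcs_snoc)
    note pq = slice_arcs_levels[OF this]
    have "f' p = extended_colour ?n g ws ws' p" "f' q = extended_colour ?n g ws ws' q"
      using pq agree by blast+
    then show ?thesis using arcs'[OF \<open>(p, q) \<in> slice_arcs ?n x\<close>] by simp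
  qed
  have image: "f' ` tangle_points (D @ [x]) b = g ` f ` ?P \<union> fst ` set ws'"
  proof -
    have "f' p = g (f p)" if "p \<in> ?P" for p
      using that by (cases p) (auto simp: f'_def tangle_points_def link_points_def)
    then have "f' ` ?P = g ` f ` ?P" by (simp add: image_image)
    moreover have "f' ` ({Suc ?n} \<times> {..<length b}) = fst ` set ws'"
      using len' by (force simp: f'_def in_set_conv_nth image_iff)
    moreover have "tangle_points (D @ [x]) b = ?P \<union> {Suc ?n} \<times> {..<length b}"
      unfolding tangle_points_def[of "D @ [x]"] link_points_snoc by simp
    ultimately show ?thesis by (simp add: image_Un)
  qed
  show ?case
  proof (intro exI[of _ f'] exI[of _ ws'] conjI allI impI)
    show "\<forall>(p, q) \<in> arcs (D @ [x]). f' p = f' q" using f' by blast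
    show "balanced ws'" "map snd ws' = b" using ws' b by simp_all
    show "f' (length (D @ [x]), j) = fst (ws' ! j)" for j by (simp add: f'_def)
    show "finite (f' ` tangle_points (D @ [x]) b)" unfolding image using fin by simp
    show "ends_sign ws' * (-1) ^ card (f' ` tangle_points (D @ [x]) b) = (\<Prod>x\<leftarrow>D @ [x]. slice_parity x)"
      unfolding image sgn' sgn by simp
  qed
qed

text \<open>
  A colouring that is constant along arcs takes only one value on a knot. This is Whitney's rule
  that the rotation number of a knot diagram plus its number of crossings is odd.
\<close>

lemma knot_parity:
  assumes "knot_diagram K"
  shows "(\<Prod>x\<leftarrow>K. slice_parity x) = -1"
proof -
  let ?P = "link_points K" and ?R = "(arcs K \<union> (arcs K)\<inverse>)\<^sup>*"
  have K: "tangle [] K []" and one: "card (?P // ?R) = 1"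
    using assms by (auto simp: knot_diagram_def link_components_def)
  have points: "tangle_points K [] = ?P" by (simp add: tangle_points_def)
  from tangle_colouring[OF K] obtain f :: "nat \<times> nat \<Rightarrow> nat" and ws where
    f_arcs: "\<forall>(p, q) \<in> arcs K. f p = f q" and "map snd ws = []"
    and sgn: "ends_sign ws * (-1) ^ card (f ` ?P) = (\<Prod>x\<leftarrow>K. slice_parity x)"
    unfolding points by (elim exE conjE) (rule that; assumption)
  have f: "f p = f q" if "(p, q) \<in> arcs K" for p q using f_arcs that by blast
  have const: "f p = f q" if "(p, q) \<in> ?R" for p q
    using that by (induction rule: rtrancl_induct) (auto dest: f)
  obtain X where X: "?P // ?R = {X}" using one by (auto simp: card_1_singleton_iff)
  then have "?P \<noteq> {}" by (auto simp: quotient_def)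
  then obtain p where p: "p \<in> ?P" by blast
  have "f q = f p" if "q \<in> ?P" for q
  proof -
    have "?R `` {p} \<in> ?P // ?R" "?R `` {q} \<in> ?P // ?R" using p that by (auto intro: quotientI)
    then have "?R `` {p} = ?R `` {q}" using X by simp
    then have "(p, q) \<in> ?R" by blast
    then show ?thesis using const by simp
  qed
  then have "f ` ?P = (\<lambda>_. f p) ` ?P" by (intro image_cong) simp_all
  also have "\<dots> = {f p}" using p by (rule image_constant)
  finally have "f ` ?P = {f p}" .
  then show ?thesis using sgn \<open>map snd ws = []\<close> by simp
qed

section \<open>Evaluating the tensor of a diagram slice by slice\<close>

lemma labellings_Nil: "labellings [] u v = (if u = v then {[u]} else {})"
  by (auto simp: labellings_def length_Suc_conv)

lemma labellings_Cons:
  "labellings (x # D) u v = (\<Union>w\<in>{w. compatible x u w}. (#) u ` labellings D w v)"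
proof (intro equalityI subsetI)
  fix \<sigma> assume \<sigma>: "\<sigma> \<in> labellings (x # D) u v"
  then obtain \<tau> where \<tau>: "\<sigma> = u # \<tau>" by (cases \<sigma>) (auto simp: labellings_def)
  have "\<tau> \<in> labellings D (\<tau> ! 0) v" "compatible x u (\<tau> ! 0)"
    using \<sigma> unfolding \<tau> labellings_def by (auto simp: All_less_Suc2)
  then show "\<sigma> \<in> (\<Union>w\<in>{w. compatible x u w}. (#) u ` labellings D w v)"
    unfolding \<tau> by blast
qed (auto simp: labellings_def All_less_Suc2)

lemma labellings_first: "\<sigma> \<in> labellings D u v \<Longrightarrow> \<sigma> ! 0 = u"
  by (simp add: labellings_def)

lemma finite_compatible: "finite {w :: 'n::finite list. compatible x u w}"
proof (rule finite_subset)
  show "{w. compatible x u w} \<subseteq> {w :: 'n list. set w \<subseteq> UNIV \<and> length w = length (slice_top x)}"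
    by (cases x) auto
  show "finite {w :: 'n list. set w \<subseteq> UNIV \<and> length w = length (slice_top x)}"
    by (rule finite_lists_length_eq) simp
qed

lemma finite_labellings: "finite (labellings D u (v :: 'n::finite list))"
  by (induction D arbitrary: u) (simp_all add: labellings_Nil labellings_Cons finite_compatible)

lemma tensor_Nil: "tensor M [] u v = (if u = v then 1 else 0)"
  by (simp add: tensor_def labellings_Nil)

lemma tensor_Cons:
  "tensor M (x # D) u v = (\<Sum>w | compatible x u w. slice_entry M x u w * tensor M D w v)"
proof -
  let ?e = "\<lambda>D \<sigma>. \<Prod>i<length D. slice_entry M (D ! i) (\<sigma> ! i) (\<sigma> ! Suc i)"
  have "tensor M (x # D) u v = (\<Sum>w | compatible x u w. \<Sum>\<sigma> \<in> (#) u ` labellings D w v. ?e (x # D) \<sigma>)"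
    unfolding tensor_def labellings_Cons
    by (rule sum.UNION_disjoint)
       (auto simp: finite_compatible finite_labellings dest: labellings_first)
  also have "\<dots> = (\<Sum>w | compatible x u w. slice_entry M x u w * tensor M D w v)"
  proof (rule sum.cong)
    fix w
    have "(\<Sum>\<sigma> \<in> (#) u ` labellings D w v. ?e (x # D) \<sigma>)
        = (\<Sum>\<sigma> \<in> labellings D w v. ?e (x # D) (u # \<sigma>))"
      by (subst sum.reindex) (auto simp: inj_on_def)
    also have "\<dots> = (\<Sum>\<sigma> \<in> labellings D w v. slice_entry M x u w * ?e D \<sigma>)"
      by (rule sum.cong) (auto simp: prod.lessThan_Suc_shift labellings_first simp del: prod.lessThan_Suc)
    finally show "(\<Sum>\<sigma> \<in> (#) u ` labellings D w v. ?e (x # D) \<sigma>) = slice_entry M x u w * tensor M D w v"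
      by (simp add: tensor_def sum_distrib_left)
  qed simp
  finally show ?thesis .
qed

lemma compatible_iff:
  assumes "length ul = length l" "length um = length (piece_bot p)" "length ur = length r"
  shows "compatible (l, p, r) (ul @ um @ ur) w \<longleftrightarrow>
    (\<exists>wm. length wm = length (piece_top p) \<and> w = ul @ wm @ ur)"
proof
  assume c: "compatible (l, p, r) (ul @ um @ ur) w"
  have "w = take (length l) w @ take (length (piece_top p)) (drop (length l) w)
          @ drop (length l + length (piece_top p)) w"
    by (metis append_take_drop_id drop_drop add.commute)
  moreover have "take (length l) w = ul" "drop (length l + length (piece_top p)) w = ur"
    using c assms by auto
  moreover have "length (take (length (piece_top p)) (drop (length l) w)) = length (piece_top p)"
    using c by auto
  ultimately show "\<exists>wm. length wm = length (piece_top p) \<and> w = ul @ wm @ ur" by metis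
qed (use assms in auto)

lemma tensor_slice:
  assumes "length ul = length l" "length um = length (piece_bot p)" "length ur = length r"
  shows "tensor M ((l, p, r) # D) (ul @ um @ ur) v =
    (\<Sum>wm | length wm = length (piece_top p). piece_entry M p um wm * tensor M D (ul @ wm @ ur) v)"
proof -
  have "{w. compatible (l, p, r) (ul @ um @ ur) w} =
        (\<lambda>wm. ul @ wm @ ur) ` {wm. length wm = length (piece_top p)}"
    using compatible_iff[OF assms] by auto
  moreover have "inj_on (\<lambda>wm. ul @ wm @ ur) A" for A by (simp add: inj_on_def)
  ultimately have "tensor M ((l, p, r) # D) (ul @ um @ ur) v =
      (\<Sum>wm | length wm = length (piece_top p).
        slice_entry M (l, p, r) (ul @ um @ ur) (ul @ wm @ ur) * tensor M D (ul @ wm @ ur) v)"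
    unfolding tensor_Cons by (simp only: sum.reindex o_def)
  then show ?thesis using assms by simp
qed

lemma sum_length_2:
  "(\<Sum>ws | length ws = Suc (Suc 0). f ws) = (\<Sum>a\<in>(UNIV :: 'n::finite set). \<Sum>b\<in>UNIV. f [a, b])"
proof -
  have "{ws :: 'n list. length ws = Suc (Suc 0)} = (\<lambda>(a, b). [a, b]) ` UNIV"
    by (auto simp: length_Suc_conv)
  then have "(\<Sum>ws | length ws = Suc (Suc 0). f ws) = (\<Sum>p\<in>UNIV. f (case p of (a, b) \<Rightarrow> [a, b]))"
    by (simp add: sum.reindex inj_on_def case_prod_beta prod_eq_iff)
  then show ?thesis by (simp add: sum.cartesian_product case_prod_beta)
qed

lemma tensor_Cup:
  assumes "length ul = length l" "length ur = length r"
  shows "tensor M ((l, Cup d, r) # D) (ul @ ur) v =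
    (\<Sum>a\<in>UNIV. \<Sum>b\<in>UNIV. cup_mat M d $ a $ b * tensor M D (ul @ [a, b] @ ur) v)"
  using tensor_slice[of ul l "[]" "Cup d" ur r M D v] assms by (simp add: sum_length_2)

lemma tensor_Cap:
  assumes "length ul = length l" "length ur = length r"
  shows "tensor M ((l, Cap d, r) # D) (ul @ [a, b] @ ur) v =
    cap_mat M d $ a $ b * tensor M D (ul @ ur) v"
  using tensor_slice[of ul l "[a, b]" "Cap d" ur r M D v] assms by simp

lemma matrix_inv_mat:
  assumes "(s :: complex) \<noteq> 0"
  shows "matrix_inv (mat s :: complex ^ 'm::finite ^ 'm) = mat (inverse s)"
proof -
  have mult: "(mat a :: complex ^ 'm ^ 'm) ** mat b = mat (a * b)" for a b
    by (simp add: matrix_matrix_mult_def mat_def vec_eq_iff if_distrib[where f = "\<lambda>x. x * _"] cong: if_cong)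
  let ?S = "mat s :: complex ^ 'm ^ 'm"
  have "?S ** mat (inverse s) = mat 1 \<and> mat (inverse s) ** ?S = mat 1"
    using assms by (simp add: mult)
  then have "matrix_inv ?S ** ?S = mat 1"
    unfolding matrix_inv_def by (rule someI2) simp
  then have "(matrix_inv ?S ** ?S) ** mat (inverse s) = mat (inverse s)"
    by simp
  then show ?thesis
    using assms by (simp add: mult flip: matrix_mul_assoc)
qed

section \<open>A scalar crossing forces dimension one\<close>

lemma crossing_mat_scalar:
  assumes "R_at_positive M" "crossing_op M = mat s" "s \<noteq> 0"
  shows "crossing_mat M ov = mat (s powi crossing_sign ov)"
  using assms by (cases ov) (simp_all add: crossing_mat_def matrix_inv_mat)

lemma tensor_Crossing:
  assumes "length ul = length l" "length ur = length r" "crossing_mat M ov = mat t"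
  shows "tensor M ((l, Crossing ov, r) # D) (ul @ [a, b] @ ur) v =
    t * tensor M D (ul @ [a, b] @ ur) v"
proof -
  have "tensor M ((l, Crossing ov, r) # D) (ul @ [a, b] @ ur) v =
    (\<Sum>c\<in>UNIV. \<Sum>d\<in>UNIV. mat t $ (a, b) $ (c, d) * tensor M D (ul @ [c, d] @ ur) v)"
    using tensor_slice[of ul l "[a, b]" "Crossing ov" ur r M D v] assms by (simp add: sum_length_2)
  also have "\<dots> = (\<Sum>c\<in>UNIV. \<Sum>d\<in>UNIV. if c = a then if d = b then t * tensor M D (ul @ [c, d] @ ur) v else 0 else 0)"
    by (intro sum.cong) (auto simp: mat_def)
  also have "\<dots> = (\<Sum>c\<in>UNIV. if c = a then t * tensor M D (ul @ [c, b] @ ur) v else 0)"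
    by (intro sum.cong) auto
  also have "\<dots> = t * tensor M D (ul @ [a, b] @ ur) v" by simp
  finally show ?thesis .
qed

lemma place_empty [simp]: "place [] [] D = D"
  by (induction D) (auto simp: place_def)

lemma regularly_isotopic_local_move:
  assumes "isotopy_move L L' \<or> R2_move L L' \<or> R3_move L L'" "tangle a L b" "tangle a L' b"
  shows "regularly_isotopic a b L L'"
proof -
  have "diagram_step a b ([] @ place [] [] L @ []) ([] @ place [] [] L' @ [])"
    using assms by (intro diagram_step.intros) simp_all
  then show ?thesis unfolding regularly_isotopic_def by (simp add: r_into_equivclp)
qed

lemma state_model_local_move:
  assumes "oriented_quantum_state_model M"
    and "isotopy_move L L' \<or> R2_move L L' \<or> R3_move L L'" "tangle a L b" "tangle a L' b"
    and "length u = length a" "length v = length b"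
  shows "tensor M L u v = tensor M L' u v"
  using assms regularly_isotopic_local_move[OF assms(2-4)]
  unfolding oriented_quantum_state_model_def by blast

text \<open>
  When the crossings are scalar, the two antiparallel crossings of the second move consist of the
  maximum at the bottom, a circle in the middle and the minimum at the top. The tensor therefore
  has rank at most one as an operator from the lower to the upper endpoints.
\<close>

lemma antiparallel_R2_tensor:
  fixes M :: "'n::finite state_model"
  assumes "crossing_mat M From_Left = mat t" "crossing_mat M From_Right = mat t'"
  shows "tensor M (cross Up Down From_Left @ cross Down Up From_Right) [p, q] [z, w] =
    (\<Sum>x\<in>UNIV. \<Sum>y\<in>UNIV. cup_mat M Down $ x $ y * cap_mat M Down $ x $ y) * t * t' *
      (cap_mat M Up $ p $ q * cup_mat M Up $ z $ w)"
proof -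
  define D6 D5 D4 D3 D2 D1 :: diagram where "D6 = [([], Cap Down, [Up, Down])]"
    and "D5 = ([Down], Crossing From_Left, [Down]) # D6"
    and "D4 = ([Down, Up], Cup Up, []) # D5"
    and "D3 = ([Down, Up], Cap Up, []) # D4"
    and "D2 = ([Down], Crossing From_Right, [Down]) # D3"
    and "D1 = ([], Cup Down, [Up, Down]) # D2"
  note D_defs = D6_def D5_def D4_def D3_def D2_def D1_def
  let ?v = "[z, w]"
  have t6: "tensor M D6 [x, y, z', w'] ?v =
      (if z' = z then if w' = w then cap_mat M Down $ x $ y else 0 else 0)" for x y z' w'
    using tensor_Cap[of "[]" "[]" "[z', w']" "[Up, Down]" M Down "[]" x y ?v]
    by (simp add: D6_def tensor_Nil)
  have t5: "tensor M D5 [x, y, z', w'] ?v = t * tensor M D6 [x, y, z', w'] ?v" for x y z' w'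
    using tensor_Crossing[of "[x]" "[Down]" "[w']" "[Down]" M From_Left t D6 y z' ?v] assms
    by (simp add: D5_def)
  have t4: "tensor M D4 [x, y] ?v = cup_mat M Up $ z $ w * t * cap_mat M Down $ x $ y" for x y
  proof -
    have "tensor M D4 [x, y] ?v = (\<Sum>a\<in>UNIV. \<Sum>b\<in>UNIV. if a = z then if b = w then
        cup_mat M Up $ a $ b * t * cap_mat M Down $ x $ y else 0 else 0)"
      using tensor_Cup[of "[x, y]" "[Down, Up]" "[]" "[]" M Up D5 ?v]
      by (auto simp: D4_def t5 t6 intro!: sum.cong)
    also have "\<dots> = (\<Sum>a\<in>UNIV. if a = z then cup_mat M Up $ a $ w * t * cap_mat M Down $ x $ y else 0)"
      by (intro sum.cong) auto
    finally show ?thesis by simp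
  qed
  have t3: "tensor M D3 [x, y, p, q] ?v = cap_mat M Up $ p $ q * tensor M D4 [x, y] ?v" for x y
    using tensor_Cap[of "[x, y]" "[Down, Up]" "[]" "[]" M Up D4 p q ?v] by (simp add: D3_def)
  have t2: "tensor M D2 [x, y, p, q] ?v = t' * tensor M D3 [x, y, p, q] ?v" for x y
    using tensor_Crossing[of "[x]" "[Down]" "[q]" "[Down]" M From_Right t' D3 y p ?v] assms
    by (simp add: D2_def)
  have "tensor M D1 [p, q] ?v =
      (\<Sum>x\<in>UNIV. \<Sum>y\<in>UNIV. cup_mat M Down $ x $ y * tensor M D2 [x, y, p, q] ?v)"
    using tensor_Cup[of "[]" "[]" "[p, q]" "[Up, Down]" M Down D2 ?v] by (simp add: D1_def)
  also have "\<dots> = (\<Sum>x\<in>UNIV. \<Sum>y\<in>UNIV. cup_mat M Down $ x $ y * cap_mat M Down $ x $ y) * t * t' *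
      (cap_mat M Up $ p $ q * cup_mat M Up $ z $ w)"
    unfolding t2 t3 t4 by (simp add: sum_distrib_left sum_distrib_right mult_ac)
  finally show ?thesis unfolding D_defs by simp
qed

text \<open>
  The second move turns the rank one operator of \<open>antiparallel_R2_tensor\<close> into the identity of
  \<open>V \<otimes> V\<^sup>*\<close>, whose rank is the square of the dimension. Concretely, for \<open>i \<noteq> j\<close> the diagonal entries
  show that all factors of some vanishing off-diagonal entry are nonzero.
\<close>

lemma scalar_crossing_dimension:
  fixes M :: "'n::finite state_model"
  assumes "oriented_quantum_state_model M"
    and "crossing_mat M From_Left = mat t" "crossing_mat M From_Right = mat t'"
  shows "(i :: 'n) = j"
proof (rule ccontr)
  assume "i \<noteq> j"
  let ?L = "cross Up Down From_Left @ cross Down Up From_Right"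
  define \<kappa> where "\<kappa> = (\<Sum>x\<in>UNIV. \<Sum>y\<in>UNIV. cup_mat M Down $ x $ y * cap_mat M Down $ x $ y) * t * t'"
  have "tensor M ?L [p, q] [z, w] = tensor M [] [p, q] [z, w]" for p q z w
    using R2_move.intros[of Up Down From_Left]
    by (intro state_model_local_move[OF assms(1), where a = "[Up, Down]" and b = "[Up, Down]"]) simp_all
  then have id: "\<kappa> * (cap_mat M Up $ p $ q * cup_mat M Up $ z $ w) = (if p = z \<and> q = w then 1 else 0)"
    for p q z w
    unfolding antiparallel_R2_tensor[OF assms(2,3)] \<kappa>_def by (simp add: tensor_Nil)
  have "\<kappa> \<noteq> 0" "cap_mat M Up $ i $ i \<noteq> 0" using id[of i i i i] by auto
  moreover have "cup_mat M Up $ j $ i \<noteq> 0" using id[of j i j i] by auto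
  ultimately show False using id[of i i j i] \<open>i \<noteq> j\<close> by simp
qed

section \<open>State sums in dimension one\<close>

fun piece_weight :: "'n::finite state_model \<Rightarrow> 'n \<Rightarrow> piece \<Rightarrow> complex" where
  "piece_weight M i (Cup d) = cup_mat M d $ i $ i"
| "piece_weight M i (Cap d) = cap_mat M d $ i $ i"
| "piece_weight M i (Crossing ov) = crossing_mat M ov $ (i, i) $ (i, i)"

text \<open>
  There is only one labelling, since all labels are \<open>i\<close>.
\<close>

lemma tensor_dimension_one:
  fixes M :: "'n::finite state_model" and i :: 'n
  assumes one: "\<And>j :: 'n. j = i"
  shows "tangle a D b \<Longrightarrow> length u = length a \<Longrightarrow> length v = length b \<Longrightarrow>
    tensor M D u v = (\<Prod>(l, p, r)\<leftarrow>D. piece_weight M i p)"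
proof (induction D arbitrary: a u)
  case Nil
  have "u = v" using Nil one by (intro nth_equalityI) (auto, metis)
  then show ?case by (simp add: tensor_Nil)
next
  case (Cons x D)
  obtain l p r where x: "x = (l, p, r)" by (cases x)
  let ?w = "replicate (length (slice_top x)) i"
  have all: "w = replicate (length w) i" for w :: "'n list"
    using one by (intro replicate_eqI) auto
  have len: "length u = length (slice_bot x)" using Cons.prems by simp
  have "compatible x u w \<longleftrightarrow> w = ?w" for w
  proof -
    have u: "u = replicate (length l) i @ replicate (length (piece_bot p)) i @ replicate (length r) i"
      using all[of u] len x by (simp add: replicate_add)
    have "length wm = n \<longleftrightarrow> wm = replicate n i" for wm n
      using all[of wm] by (metis length_replicate)
    then show ?thesis
      unfolding x by (subst u, subst compatible_iff) (auto simp: replicate_add)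
  qed
  then have "Collect (compatible x u) = {?w}" by auto
  then have "tensor M (x # D) u v = slice_entry M x u ?w * tensor M D ?w v"
    unfolding tensor_Cons by simp
  also have "slice_entry M x u ?w = piece_weight M i p"
  proof -
    have mid: "take m (drop k (replicate n i)) = replicate m i" if "k + m \<le> n" for k m n
      using that by simp
    have "slice_entry M x u ?w =
        piece_entry M p (replicate (length (piece_bot p)) i) (replicate (length (piece_top p)) i)"
      using all[of u] len unfolding x slice_entry.simps by (metis (no_types, lifting)
        mid add.assoc le_add1 length_append slice_bot.simps slice_top.simps)
    then show ?thesis by (cases p) simp_all
  qed
  also have "tensor M D ?w v = (\<Prod>(l, p, r)\<leftarrow>D. piece_weight M i p)"
    using Cons.prems by (intro Cons.IH[of "slice_top x"]) auto
  finally show ?case by (simp add: x)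
qed

lemma zigzag_weight:
  fixes M :: "'n::finite state_model" and i :: 'n
  assumes "oriented_quantum_state_model M" "\<And>j :: 'n. j = i"
  shows "cup_mat M (opp d) $ i $ i * cap_mat M d $ i $ i = 1"
proof -
  let ?L = "[([d], Cup (opp d), []), ([], Cap d, [d])]"
  have L: "tangle [d] ?L [d]" by simp
  have "tensor M ?L [i] [i] = tensor M [] [i] [i]"
    by (intro state_model_local_move[OF assms(1), where a = "[d]" and b = "[d]"])
       (simp_all add: isotopy_move.zigzag_right)
  then show ?thesis
    using tensor_dimension_one[OF assms(2) L, of "[i]" "[i]" M] by (simp add: tensor_Nil)
qed

lemma circle_weight:
  fixes M :: "'n::finite state_model" and i :: 'n
  assumes "oriented_quantum_state_model M" "\<And>j :: 'n. j = i"
  shows "cup_mat M d $ i $ i * cap_mat M d $ i $ i = circle_value M"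
proof -
  have "tangle [] (circle d) []" by (simp add: circle_def)
  then have "state_sum M (circle d) = cup_mat M d $ i $ i * cap_mat M d $ i $ i"
    using tensor_dimension_one[OF assms(2), of "[]" "circle d" "[]" "[]" "[]" M]
    by (simp add: state_sum_def circle_def)
  then show ?thesis using assms(1) by (simp add: oriented_quantum_state_model_def)
qed

text \<open>
  Half of the change in the number of strands. Its sum over a link diagram vanishes, which says
  that there are as many minima as maxima.
\<close>

fun pair_change :: "slice \<Rightarrow> int" where
  "pair_change (l, Cup d, r) = 1"
| "pair_change (l, Cap d, r) = -1"
| "pair_change (l, Crossing ov, r) = 0"

lemma tangle_pair_change:
  "tangle a D b \<Longrightarrow> int (length b) = int (length a) + 2 * (\<Sum>x\<leftarrow>D. pair_change x)"
proof (induction D arbitrary: a)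
  case (Cons x D)
  have "int (length (slice_top x)) = int (length (slice_bot x)) + 2 * pair_change x"
    by (cases x rule: pair_change.cases) auto
  then show ?case using Cons.IH[of "slice_top x"] Cons.prems by auto
qed simp

text \<open>
  The cancellation of minima against maxima and the values of the two circles leave only one free
  parameter \<open>\<beta>\<close> and a sign \<open>\<delta>\<close>: the maxima \<open>Cap Up\<close>, \<open>Cap Down\<close> have the values \<open>1 / \<beta>\<close>,
  \<open>\<delta> / \<beta>\<close> and the minima \<open>Cup Down\<close>, \<open>Cup Up\<close> the values \<open>\<beta>\<close>, \<open>\<delta> \<beta>\<close>. The square of \<open>\<delta>\<close> is
  the product of the weights of both circles, that is, of all four pieces, and these cancel in
  pairs. In the formula a crossing has an additional \<open>\<delta>\<close> in each of the first two factors,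
  and the two cancel.
\<close>

lemma slice_weight:
  fixes M :: "'n::finite state_model" and i :: 'n
  assumes M: "oriented_quantum_state_model M" and one: "\<And>j :: 'n. j = i"
    and cross: "\<And>ov. crossing_mat M ov = mat (s powi crossing_sign ov)" and "s \<noteq> 0"
  defines "\<delta> \<equiv> circle_value M" and "\<beta> \<equiv> cup_mat M Down $ i $ i"
  shows "\<delta> = 1 \<or> \<delta> = -1" and "\<beta> \<noteq> 0"
    and "piece_weight M i p = (s * \<delta>) powi slice_sign (l, p, r)
      * (if \<delta> = 1 then 1 else of_int (slice_parity (l, p, r))) * \<beta> powi pair_change (l, p, r)"
proof -
  have zig: "cup_mat M Up $ i $ i * cap_mat M Down $ i $ i = 1"
    "\<beta> * cap_mat M Up $ i $ i = 1"
    using zigzag_weight[OF M one, of Down] zigzag_weight[OF M one, of Up] by (simp_all add: \<beta>_def)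
  have circ: "cup_mat M Up $ i $ i * cap_mat M Up $ i $ i = \<delta>"
    "\<beta> * cap_mat M Down $ i $ i = \<delta>"
    using circle_weight[OF M one] by (simp_all add: \<beta>_def \<delta>_def)
  show \<beta>: "\<beta> \<noteq> 0" using zig(2) by auto
  \<comment> \<open>regroup the four pieces of the two circles into the two zigzags\<close>
  have "\<delta> * \<delta> = (cup_mat M Up $ i $ i * cap_mat M Up $ i $ i) * (\<beta> * cap_mat M Down $ i $ i)"
    by (simp only: circ)
  also have "\<dots> = (cup_mat M Up $ i $ i * cap_mat M Down $ i $ i) * (\<beta> * cap_mat M Up $ i $ i)"
    by (simp only: mult_ac)
  finally have sq: "\<delta> * \<delta> = 1" using zig by simp
  then show \<delta>: "\<delta> = 1 \<or> \<delta> = -1" by (simp add: square_eq_1_iff)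
  have vals: "cap_mat M Up $ i $ i = inverse \<beta>" "cap_mat M Down $ i $ i = \<delta> * inverse \<beta>"
    "cup_mat M Up $ i $ i = \<delta> * \<beta>"
    using zig circ \<beta> sq by (auto simp: field_simps)
  show "piece_weight M i p = (s * \<delta>) powi slice_sign (l, p, r)
      * (if \<delta> = 1 then 1 else of_int (slice_parity (l, p, r))) * \<beta> powi pair_change (l, p, r)"
  proof (cases p)
    case (Cup d)
    then show ?thesis using \<delta> vals by (cases d) (auto simp: \<beta>_def)
  next
    case (Cap d)
    then show ?thesis using \<delta> vals by (cases d) auto
  next
    case (Crossing ov)
    then show ?thesis using \<delta> cross by (cases ov) (auto simp: mat_def)
  qed
qed

lemma prod_list_powi:
  fixes A \<beta> :: complex
  assumes "A \<noteq> 0" "\<beta> \<noteq> 0" "\<And>x. x \<in> set D \<Longrightarrow> w x = A powi m x * c x * \<beta> powi n x"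
  shows "(\<Prod>x\<leftarrow>D. w x) = A powi (\<Sum>x\<leftarrow>D. m x) * (\<Prod>x\<leftarrow>D. c x) * \<beta> powi (\<Sum>x\<leftarrow>D. n x)"
  using assms(3) by (induction D) (simp_all add: power_int_add assms(1,2) mult_ac)

text \<open>
  The parameter \<open>\<beta>\<close> cancels because minima and maxima are equal in number. The sign \<open>\<delta>\<close> occurs to
  an odd power by \<open>knot_parity\<close>, apart from the powers collected in the writhe factor.
\<close>

lemma knot_state_sum:
  fixes M :: "'n::finite state_model"
  assumes M: "oriented_quantum_state_model M" "R_at_positive M" "crossing_op M = mat s" "s \<noteq> 0"
    and K: "knot_diagram K"
  shows "state_sum M K = (s * circle_value M) powi writhe K * circle_value M"
proof -
  define i :: 'n where "i = undefined"
  let ?\<delta> = "circle_value M" and ?\<beta> = "cup_mat M Down $ i $ i"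
  let ?c = "\<lambda>x. if ?\<delta> = 1 then 1 else of_int (slice_parity x) :: complex"
  note cross = crossing_mat_scalar[OF M(2-4)]
  have one: "j = i" for j :: 'n
    by (rule scalar_crossing_dimension[OF M(1) cross cross])
  note weight = slice_weight[OF M(1) one cross \<open>s \<noteq> 0\<close>]
  have tangle: "tangle [] K []" using K by (simp add: knot_diagram_def)
  have "state_sum M K = (\<Prod>(l, p, r)\<leftarrow>K. piece_weight M i p)"
    unfolding state_sum_def by (rule tensor_dimension_one[OF one tangle]) simp_all
  also have "\<dots> = (s * ?\<delta>) powi writhe K * (\<Prod>x\<leftarrow>K. ?c x) * ?\<beta> powi (\<Sum>x\<leftarrow>K. pair_change x)"
    unfolding writhe_def
  proof (rule prod_list_powi)
    show "s * ?\<delta> \<noteq> 0" "?\<beta> \<noteq> 0" using weight(1,2) \<open>s \<noteq> 0\<close> by auto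
    show "(case x of (l, p, r) \<Rightarrow> piece_weight M i p) =
        (s * ?\<delta>) powi slice_sign x * ?c x * ?\<beta> powi pair_change x" for x
      using weight(3) by (cases x) (simp only: prod.case)
  qed
  also have "(\<Sum>x\<leftarrow>K. pair_change x) = 0" using tangle_pair_change[OF tangle] by simp
  also have "(\<Prod>x\<leftarrow>K. ?c x) = ?\<delta>"
  proof (cases "?\<delta> = 1")
    case True
    then show ?thesis by (simp add: map_replicate_const)
  next
    case False
    have "(\<Prod>x\<leftarrow>K. of_int (slice_parity x)) = (of_int (\<Prod>x\<leftarrow>K. slice_parity x) :: complex)"
      by (induction K) simp_all
    then show ?thesis using False weight(1) knot_parity[OF K] by simp
  qed
  finally show ?thesis by simp
qed

theorem theorem4p1:
  fixes M :: "'n::finite state_model"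
    and F G :: "complex ^ 'n ^ 'n"
    and s :: complex
    and K :: diagram
  assumes "oriented_quantum_state_model M"
    and "invertible F" and "invertible G"
    and "crossing_op M = kronecker F G"
    and "R_at_positive M"
    and "s \<noteq> 0" and "crossing_op M = mat s"
    and "knot_diagram K"
  shows "normalized_invariant M s K = 1"
proof -
  have "circle_value M \<noteq> 0" using assms(1) by (simp add: oriented_quantum_state_model_def)
  then show ?thesis
    using knot_state_sum[OF assms(1,5,7,6,8)] \<open>s \<noteq> 0\<close>
    by (simp add: normalized_invariant_def bracket_def power_int_minus)
qed

end
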